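(* Let $C_{1},\ldots,C_{m}\in\mathbb{R}_{+}^{n\times n}$ be pairwise comparison matrices with nonzero spectral radii, and let $B\in\mathbb{R}_{+}^{n\times n}$ be a matrix such that $\mathrm{Tr}(B)\leq 1$ (all matrix operations are in max-algebra). Consider the multiobjective problem of minimizing $(x^{-}C_{1}x,\ldots,x^{-}C_{m}x)$ over regular vectors $x\in\mathbb{R}_{+}^{n}$ subject to $Bx\leq x$. Denote $B_{0}=B$ and $I_{0}=\{1,\ldots,m\}$, and define the recurrence relations, for $s=1,\ldots,m$, $$A_{s}=\bigoplus_{l\in I_{s-1}}C_{l},\qquad \theta_{s}=\bigoplus_{k=1}^{n}\ \bigoplus_{0\leq i_{1}+\cdots+i_{k}\leq n-k}\mathrm{tr}^{1/k}(A_{s}B_{s-1}^{i_{1}}\cdots A_{s}B_{s-1}^{i_{k}}),\qquad B_{s}=\theta_{s}^{-1}A_{s}\oplus B_{s-1},$$ $$\theta_{sl}=\bigoplus_{k=1}^{n}\ \bigoplus_{0\leq i_{1}+\cdots+i_{k}\leq n-k}\mathrm{tr}^{1/k}(C_{l}B_{s}^{i_{1}}\cdots C_{l}B_{s}^{i_{k}}),\quad l\in I_{s-1},\qquad I_{s}=\{l\in I_{s-1}:\ \theta_{s}>\theta_{sl}\},$$ where $i_1,\ldots,i_k$ range over nonnegative integers; if $I_{s}=\emptyset$ for some $s<m$, the recursion stops and one sets $B_{m}=B_{s}$ for the first such $s$. Then, with $G=B_{m}^{\ast}$ and $g_1,\ldots,g_n$ the columns of $G$, the following statements hold: (i) All lexicographic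 max-ordering solutions of the problem are given in the parametric form $x=Gu$, $u\in\mathbb{R}_+^n$, $u\neq 0$. (ii) The minimal normalized best differentiating solution is given by $$x^{\mathrm{best}}=g_{k}\|g_{k}\|^{-1},\qquad k\in\arg\max_{1\leq j\leq n}\|g_{j}\|\,\|g_{j}^{-}\|.$$ (iii) The maximal normalized worst differentiating solution is $x^{\mathrm{worst}}=(\mathbf{1}^{T}G)^{-}$.
   Context: Max-algebra: the set $\mathbb{R}_{+}$ of nonnegative reals with addition $a\oplus b=\max(a,b)$ and the usual multiplication. Matrices and vectors over $\mathbb{R}_+$ are added and multiplied by the usual rules with $+$ replaced by $\oplus$; inequalities are entrywise; $I$ is the usual identity matrix; $A^{0}=I$, $A^{p}=AA^{p-1}$ for integers $p\geq 1$. A vector is regular if it has no zero entries. $\mathbf{1}=(1,\ldots,1)^{T}$. The conjugate of a nonzero matrix $A=(a_{ij})$ is $A^{-}=(a^{-}_{ij})$, of transposed size, with $a^{-}_{ij}=a_{ji}^{-1}$ if $a_{ji}\neq 0$ and $0$ otherwise (likewise for row and column vectors). $\|x\|=\max_{j}x_{j}$ for row or column vectors. For $A=(a_{ij})\in\mathbb{R}_+^{n\times n}$: $\mathrm{tr}A=\bigoplus_{k}a_{kk}$; $\mathrm{tr}^{1/k}(A)=(\mathrm{tr}A)^{1/k}$; $\mathrm{Tr}(A)=\bigoplus_{k=1}^{n}\mathrm{tr}A^{k}$; the spectral radius is $\bigoplus_{k=1}^{n}\mathrm{tr}^{1/k}(A^{k})$; if $\mathrm{Tr}(A)\leq 1$,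 the Kleene star is $A^{\ast}=\bigoplus_{k=0}^{n-1}A^{k}$. A pairwise comparison matrix is a matrix $C=(c_{ij})$ with $c_{ij}>0$ and $c_{ij}=1/c_{ji}$ for all $i,j$. Lexicographic max-ordering solutions are defined by the following procedure. Let $X_{0}$ be the set of regular $x$ with $Bx\leq x$, and $J_{0}=\{1,\ldots,m\}$. For $s=1,2,\ldots,m$: let $X_{s}$ be the set of minimizers of $\max_{l\in J_{s-1}}x^{-}C_{l}x$ over $x\in X_{s-1}$, let $\mu_{s}$ be the corresponding minimum value, and let $J_{s}=\{l\in J_{s-1}:\ \mu_{s}>\min_{x\in X_{s}}x^{-}C_{l}x\}$. The procedure stops at step $s$ if $J_{s}=\emptyset$ or $s=m$ (one may also stop if $X_{s}$ consists of a single vector up to a positive factor, as then the set no longer changes). The lexicographic max-ordering solutions are the elements of the last set $X_{s}$ obtained. Let $X$ be the set of lexicographic max-ordering solutions. A normalized best (respectively worst) differentiating solution is a vector that maximizes (respectively minimizes) $x^{-}\mathbf{1}=\max_i x_i^{-1}$ over all $x\in X$ with $\mathbf{1}^{T}x=\max_i x_i=1$. The maximal worst differentiating solution is the worst differentiating solution that is entrywise $\geq$ every other one. The minimal best differentiating solution is "given by" a finite set $S$ of vectors in the following sense: each vector of $S$ is a normalized best differentiating solution, and every normalized best differentiating solution is entrywise $\geq$ some vector of $S$; if $S$ has an entrywise least element, that is the unique minimal best differentiating solution, and otherwise the minimal solution is not uniquely determined. *)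

theory Defs
  imports "HOL-Analysis.Analysis"
begin

text \<open>
  Max-algebra is the set of nonnegative reals with maximum as addition and the usual
  multiplication. Vectors and matrices are taken over the reals, and nonnegativity of the
  entries is required explicitly where it is needed. Row and column vectors share the type
  \<^typ>\<open>real ^ 'n\<close>. The order on vectors and matrices is the entrywise one of the library,
  and \<^term>\<open>1 :: real ^ 'n\<close> is the vector of ones.
\<close>

definition nonneg_vec :: "real ^ 'n \<Rightarrow> bool" where
  "nonneg_vec x \<longleftrightarrow> (\<forall>i. 0 \<le> x $ i)"

definition nonneg_mat :: "real ^ 'n ^ 'm \<Rightarrow> bool" where
  "nonneg_mat A \<longleftrightarrow> (\<forall>i j. 0 \<le> A $ i $ j)"

definition regular_vec :: "real ^ 'n \<Rightarrow> bool" where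
  "regular_vec x \<longleftrightarrow> (\<forall>i. x $ i \<noteq> 0)"

definition mx_add :: "real ^ 'n ^ 'm \<Rightarrow> real ^ 'n ^ 'm \<Rightarrow> real ^ 'n ^ 'm" (infixl "\<oplus>\<^sub>m" 65) where
  "A \<oplus>\<^sub>m B = (\<chi> i j. max (A $ i $ j) (B $ i $ j))"

definition mx_sum :: "nat set \<Rightarrow> (nat \<Rightarrow> real ^ 'n ^ 'm) \<Rightarrow> real ^ 'n ^ 'm" where
  "mx_sum L C = (\<chi> i j. MAX l\<in>L. C l $ i $ j)"

definition mx_mult :: "real ^ 'n ^ 'm \<Rightarrow> real ^ 'p ^ 'n \<Rightarrow> real ^ 'p ^ 'm" (infixl "\<otimes>\<^sub>m" 70) where
  "A \<otimes>\<^sub>m B = (\<chi> i j. MAX k. A $ i $ k * B $ k $ j)"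

definition mx_mult_vec :: "real ^ 'n ^ 'm \<Rightarrow> real ^ 'n \<Rightarrow> real ^ 'm" (infixr "\<otimes>\<^sub>v" 70) where
  "A \<otimes>\<^sub>v x = (\<chi> i. MAX j. A $ i $ j * x $ j)"

definition vec_mx_mult :: "real ^ 'm \<Rightarrow> real ^ 'n ^ 'm \<Rightarrow> real ^ 'n" (infixl "\<^sub>v\<otimes>" 70) where
  "y \<^sub>v\<otimes> A = (\<chi> j. MAX i. y $ i * A $ i $ j)"

definition mx_dot :: "real ^ 'n \<Rightarrow> real ^ 'n \<Rightarrow> real" (infix "\<odot>" 70) where
  "y \<odot> x = (MAX i. y $ i * x $ i)"

definition mx_norm :: "real ^ 'n \<Rightarrow> real" where
  "mx_norm x = (MAX j. x $ j)"

definition conjugate :: "real ^ 'n \<Rightarrow> real ^ 'n" where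
  "conjugate x = (\<chi> i. if x $ i \<noteq> 0 then inverse (x $ i) else 0)"

primrec mx_power :: "real ^ 'n ^ 'n \<Rightarrow> nat \<Rightarrow> real ^ 'n ^ 'n" where
  "mx_power A 0 = mat 1"
| "mx_power A (Suc p) = A \<otimes>\<^sub>m mx_power A p"

definition mx_tr :: "real ^ 'n ^ 'n \<Rightarrow> real" where
  "mx_tr A = (MAX k. A $ k $ k)"

definition mx_Tr :: "real ^ 'n ^ 'n \<Rightarrow> real" where
  "mx_Tr A = (MAX k\<in>{1..CARD('n)}. mx_tr (mx_power A k))"

definition mx_spectral_radius :: "real ^ 'n ^ 'n \<Rightarrow> real" where
  "mx_spectral_radius A = (MAX k\<in>{1..CARD('n)}. root k (mx_tr (mx_power A k)))"

definition kleene_star :: "real ^ 'n ^ 'n \<Rightarrow> real ^ 'n ^ 'n" where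
  "kleene_star A = mx_sum {0..CARD('n) - 1} (mx_power A)"

definition pairwise_comparison :: "real ^ 'n ^ 'n \<Rightarrow> bool" where
  "pairwise_comparison C \<longleftrightarrow> (\<forall>i j. 0 < C $ i $ j \<and> C $ i $ j = 1 / C $ j $ i)"

text \<open>A list \<open>[i\<^sub>1, \<dots>, i\<^sub>k]\<close> of exponents encodes the product
  \<open>A B\<^bsup>i\<^sub>1\<^esup> \<cdots> A B\<^bsup>i\<^sub>k\<^esup>\<close>.\<close>

definition mx_word :: "real ^ 'n ^ 'n \<Rightarrow> real ^ 'n ^ 'n \<Rightarrow> nat list \<Rightarrow> real ^ 'n ^ 'n" where
  "mx_word A B is = foldr (\<lambda>i M. (A \<otimes>\<^sub>m mx_power B i) \<otimes>\<^sub>m M) is (mat 1)"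

definition theta :: "real ^ 'n ^ 'n \<Rightarrow> real ^ 'n ^ 'n \<Rightarrow> real" where
  "theta A B =
     (MAX k\<in>{1..CARD('n)}. MAX is\<in>{is. length is = k \<and> sum_list is \<le> CARD('n) - k}.
        root k (mx_tr (mx_word A B is)))"

text \<open>The state after \<open>s\<close> steps is the pair \<open>(B\<^sub>s, I\<^sub>s)\<close>. It is left unchanged once
  \<open>I\<^sub>s\<close> is empty, so that the state at \<open>m\<close> then repeats the one at which the recursion
  stopped.\<close>

primrec bound_state ::
  "(nat \<Rightarrow> real ^ 'n ^ 'n) \<Rightarrow> nat \<Rightarrow> real ^ 'n ^ 'n \<Rightarrow> nat \<Rightarrow> (real ^ 'n ^ 'n) \<times> nat set" where
  "bound_state C m B 0 = (B, {1..m})"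
| "bound_state C m B (Suc s) =
     (let (B', I) = bound_state C m B s in
      if I = {} then (B', I)
      else let A = mx_sum I C; \<theta> = theta A B'; B'' = inverse \<theta> *\<^sub>R A \<oplus>\<^sub>m B'
           in (B'', {l \<in> I. \<theta> > theta (C l) B''}))"

definition minimum_on :: "('a \<Rightarrow> real) \<Rightarrow> 'a set \<Rightarrow> real" where
  "minimum_on f X = (LEAST v. v \<in> f ` X)"

definition objective :: "real ^ 'n ^ 'n \<Rightarrow> real ^ 'n \<Rightarrow> real" where
  "objective C x = conjugate x \<odot> (C \<otimes>\<^sub>v x)"

text \<open>The state after \<open>s\<close> steps is the pair \<open>(X\<^sub>s, J\<^sub>s)\<close>, again left unchanged once
  \<open>J\<^sub>s\<close> is empty.\<close>

primrec lex_state ::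
  "(nat \<Rightarrow> real ^ 'n ^ 'n) \<Rightarrow> nat \<Rightarrow> real ^ 'n ^ 'n \<Rightarrow> nat \<Rightarrow> (real ^ 'n) set \<times> nat set" where
  "lex_state C m B 0 = ({x. nonneg_vec x \<and> regular_vec x \<and> B \<otimes>\<^sub>v x \<le> x}, {1..m})"
| "lex_state C m B (Suc s) =
     (let (X, J) = lex_state C m B s in
      if J = {} then (X, J)
      else let f = (\<lambda>x. MAX l\<in>J. objective (C l) x);
               X' = {x. is_arg_min f (\<lambda>x. x \<in> X) x};
               \<mu> = minimum_on f X
           in (X', {l \<in> J. \<mu> > minimum_on (objective (C l)) X'}))"

definition lex_max_solutions ::
  "(nat \<Rightarrow> real ^ 'n ^ 'n) \<Rightarrow> nat \<Rightarrow> real ^ 'n ^ 'n \<Rightarrow> (real ^ 'n) set" where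
  "lex_max_solutions C m B = fst (lex_state C m B m)"

definition best_differentiating :: "(real ^ 'n) set \<Rightarrow> (real ^ 'n) set" where
  "best_differentiating X =
     {x. is_arg_max (\<lambda>x. conjugate x \<odot> 1) (\<lambda>x. x \<in> X \<and> 1 \<odot> x = 1) x}"

definition worst_differentiating :: "(real ^ 'n) set \<Rightarrow> (real ^ 'n) set" where
  "worst_differentiating X =
     {x. is_arg_min (\<lambda>x. conjugate x \<odot> 1) (\<lambda>x. x \<in> X \<and> 1 \<odot> x = 1) x}"

definition minimal_elements :: "(real ^ 'n) set \<Rightarrow> (real ^ 'n) set" where
  "minimal_elements D = {x \<in> D. \<forall>y\<in>D. y \<le> x \<longrightarrow> y = x}"

text \<open>The last two conditions say that \<open>D\<close> has a unique minimal element, namely the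
  entrywise least element of \<open>S\<close>, if the latter exists, and that the minimal element
  of \<open>D\<close> is not unique otherwise.\<close>

definition minimal_given_by :: "(real ^ 'n) set \<Rightarrow> (real ^ 'n) set \<Rightarrow> bool" where
  "minimal_given_by D S \<longleftrightarrow>
     finite S \<and> S \<subseteq> D \<and> (\<forall>x\<in>D. \<exists>y\<in>S. y \<le> x) \<and>
     (\<forall>y\<in>S. (\<forall>z\<in>S. y \<le> z) \<longrightarrow> minimal_elements D = {y}) \<and>
     (\<not> (\<exists>y\<in>S. \<forall>z\<in>S. y \<le> z) \<longrightarrow> \<not> (\<exists>!x. x \<in> minimal_elements D))"

definition maximal_given_by :: "(real ^ 'n) set \<Rightarrow> real ^ 'n \<Rightarrow> bool" where
  "maximal_given_by D x \<longleftrightarrow> x \<in> D \<and> (\<forall>y\<in>D. y \<le> x)"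

end

theory Submission
  imports Defs
begin

text \<open>
  For positive \<open>A\<close> and for \<open>B\<close> with \<open>Tr B \<le> 1\<close>, the number \<open>\<theta> = theta A B\<close> is the least
  \<open>t\<close> for which \<open>Tr (t\<^sup>-\<^sup>1 A \<oplus> B) \<le> 1\<close>, hence the minimum of \<open>x\<^sup>- A x\<close> over
  the regular solutions of \<open>B x \<le> x\<close>; the minimizers are the regular solutions of
  \<open>(\<theta>\<^sup>-\<^sup>1 A \<oplus> B) x \<le> x\<close>. So each feasible set of the lexicographic procedure is again
  of this form, with the matrix and the index set given by the recurrence. Since the first
  step makes the matrix positive, its Kleene star \<open>G\<close> generates the last set. A normalized
  solution \<open>x\<close> with \<open>x\<^sub>k = 1\<close> lies above column \<open>k\<close> of \<open>G\<close> and below \<open>(1\<^sup>T G)\<^sup>-\<close>,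
  and \<open>x\<^sup>- 1\<close> is decreasing in \<open>x\<close>.
\<close>

section \<open>Entries of max-algebra operations\<close>

lemma MAX_le_iff:
  fixes f :: "'a :: finite \<Rightarrow> real"
  shows "(MAX i. f i) \<le> c \<longleftrightarrow> (\<forall>i. f i \<le> c)"
  by (subst Max_le_iff) auto

lemma le_MAX:
  fixes f :: "'a :: finite \<Rightarrow> real"
  shows "f i \<le> (MAX i. f i)"
  by (rule Max_ge) auto

lemma MAX_attained:
  fixes f :: "'a :: finite \<Rightarrow> real"
  obtains i where "(MAX i. f i) = f i"
proof -
  have "(MAX i. f i) \<in> range f" by (rule Max_in) auto
  then show ?thesis by (elim rangeE) (rule that)
qed

lemma mx_mult_ge: "A $ i $ k * B $ k $ j \<le> (A \<otimes>\<^sub>m B) $ i $ j"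
  using le_MAX[of "\<lambda>k. A $ i $ k * B $ k $ j" k] by (simp add: mx_mult_def)

lemma mx_mult_attained:
  obtains k where "(A \<otimes>\<^sub>m B) $ i $ j = A $ i $ k * B $ k $ j"
  using MAX_attained[of "\<lambda>k. A $ i $ k * B $ k $ j"] by (auto simp: mx_mult_def)

lemma mx_mult_vec_ge: "A $ i $ j * x $ j \<le> (A \<otimes>\<^sub>v x) $ i"
  using le_MAX[of "\<lambda>j. A $ i $ j * x $ j" j] by (simp add: mx_mult_vec_def)

lemma mx_mult_vec_attained:
  obtains j where "(A \<otimes>\<^sub>v x) $ i = A $ i $ j * x $ j"
  using MAX_attained[of "\<lambda>j. A $ i $ j * x $ j"] by (auto simp: mx_mult_vec_def)

lemma mx_mult_vec_le_iff: "(A \<otimes>\<^sub>v x) $ i \<le> c \<longleftrightarrow> (\<forall>j. A $ i $ j * x $ j \<le> c)"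
  by (simp add: mx_mult_vec_def MAX_le_iff)

lemma mx_tr_ge: "A $ i $ i \<le> mx_tr A"
  using le_MAX[of "\<lambda>i. A $ i $ i" i] by (simp add: mx_tr_def)

lemma mx_tr_attained: obtains i where "mx_tr A = A $ i $ i"
  using MAX_attained[of "\<lambda>i. A $ i $ i"] by (auto simp: mx_tr_def)

lemma mx_Tr_le_iff:
  fixes A :: "real ^ 'n ^ 'n"
  shows "mx_Tr A \<le> c \<longleftrightarrow> (\<forall>k\<in>{1..CARD('n)}. \<forall>i. mx_power A k $ i $ i \<le> c)"
  unfolding mx_Tr_def by (subst Max_le_iff) (auto simp: mx_tr_def MAX_le_iff)

lemma mx_sum_ge: "finite L \<Longrightarrow> l \<in> L \<Longrightarrow> C l $ i $ j \<le> mx_sum L C $ i $ j"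
  by (simp add: mx_sum_def)

lemma mx_sum_attained:
  assumes "finite L" "L \<noteq> {}"
  obtains l where "l \<in> L" "mx_sum L C $ i $ j = C l $ i $ j"
proof -
  have "(MAX l\<in>L. C l $ i $ j) \<in> (\<lambda>l. C l $ i $ j) ` L"
    using assms by (intro Max_in) auto
  then show ?thesis by (elim imageE) (simp add: mx_sum_def that)
qed

lemma nonneg_mat_mult: "nonneg_mat A \<Longrightarrow> nonneg_mat B \<Longrightarrow> nonneg_mat (A \<otimes>\<^sub>m B)"
  unfolding nonneg_mat_def by (metis mx_mult_attained mult_nonneg_nonneg)

lemma nonneg_mat_one: "nonneg_mat (mat 1)"
  by (simp add: nonneg_mat_def mat_def)

lemma nonneg_mat_power: "nonneg_mat A \<Longrightarrow> nonneg_mat (mx_power A p)"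
  by (induction p) (simp_all add: nonneg_mat_one nonneg_mat_mult)

lemma mx_mult_one_left:
  assumes "nonneg_mat A"
  shows "mat 1 \<otimes>\<^sub>m A = A"
proof -
  have "(mat 1 \<otimes>\<^sub>m A) $ i $ j = A $ i $ j" for i j
  proof (rule antisym)
    show "(mat 1 \<otimes>\<^sub>m A) $ i $ j \<le> A $ i $ j"
      using assms by (auto simp: mx_mult_def MAX_le_iff mat_def nonneg_mat_def)
    show "A $ i $ j \<le> (mat 1 \<otimes>\<^sub>m A) $ i $ j"
      using mx_mult_ge[of "mat 1" i i A j] by (simp add: mat_def)
  qed
  then show ?thesis by (simp add: vec_eq_iff)
qed

lemma mx_mult_one_right:
  assumes "nonneg_mat A"
  shows "A \<otimes>\<^sub>m mat 1 = A"
proof -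
  have "(A \<otimes>\<^sub>m mat 1) $ i $ j = A $ i $ j" for i j
  proof (rule antisym)
    show "(A \<otimes>\<^sub>m mat 1) $ i $ j \<le> A $ i $ j"
      using assms by (auto simp: mx_mult_def MAX_le_iff mat_def nonneg_mat_def)
    show "A $ i $ j \<le> (A \<otimes>\<^sub>m mat 1) $ i $ j"
      using mx_mult_ge[of A i j "mat 1" j] by (simp add: mat_def)
  qed
  then show ?thesis by (simp add: vec_eq_iff)
qed

text \<open>A factor can be moved inside a maximum when it is nonnegative. The entries multiplied
  with the inner maxima are those of the two outer matrices, hence the conditions on
  \<open>A\<close> and \<open>C\<close>.\<close>

lemma mx_mult_assoc:
  assumes "nonneg_mat A" "nonneg_mat C"
  shows "(A \<otimes>\<^sub>m B) \<otimes>\<^sub>m C = A \<otimes>\<^sub>m (B \<otimes>\<^sub>m C)"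
proof -
  have "((A \<otimes>\<^sub>m B) \<otimes>\<^sub>m C) $ i $ j = (A \<otimes>\<^sub>m (B \<otimes>\<^sub>m C)) $ i $ j" for i j
  proof (rule antisym)
    obtain k where k: "((A \<otimes>\<^sub>m B) \<otimes>\<^sub>m C) $ i $ j = (A \<otimes>\<^sub>m B) $ i $ k * C $ k $ j"
      by (rule mx_mult_attained)
    obtain l where l: "(A \<otimes>\<^sub>m B) $ i $ k = A $ i $ l * B $ l $ k"
      by (rule mx_mult_attained)
    have "A $ i $ l * (B $ l $ k * C $ k $ j) \<le> A $ i $ l * (B \<otimes>\<^sub>m C) $ l $ j"
      using assms by (intro mult_left_mono mx_mult_ge) (auto simp: nonneg_mat_def)
    also have "\<dots> \<le> (A \<otimes>\<^sub>m (B \<otimes>\<^sub>m C)) $ i $ j" by (rule mx_mult_ge)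
    finally show "((A \<otimes>\<^sub>m B) \<otimes>\<^sub>m C) $ i $ j \<le> (A \<otimes>\<^sub>m (B \<otimes>\<^sub>m C)) $ i $ j"
      by (simp add: k l mult.assoc)
  next
    obtain k where k: "(A \<otimes>\<^sub>m (B \<otimes>\<^sub>m C)) $ i $ j = A $ i $ k * (B \<otimes>\<^sub>m C) $ k $ j"
      by (rule mx_mult_attained)
    obtain l where l: "(B \<otimes>\<^sub>m C) $ k $ j = B $ k $ l * C $ l $ j"
      by (rule mx_mult_attained)
    have "(A $ i $ k * B $ k $ l) * C $ l $ j \<le> (A \<otimes>\<^sub>m B) $ i $ l * C $ l $ j"
      using assms by (intro mult_right_mono mx_mult_ge) (auto simp: nonneg_mat_def)
    also have "\<dots> \<le> ((A \<otimes>\<^sub>m B) \<otimes>\<^sub>m C) $ i $ j" by (rule mx_mult_ge)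
    finally show "(A \<otimes>\<^sub>m (B \<otimes>\<^sub>m C)) $ i $ j \<le> ((A \<otimes>\<^sub>m B) \<otimes>\<^sub>m C) $ i $ j"
      by (simp add: k l mult.assoc)
  qed
  then show ?thesis by (simp add: vec_eq_iff)
qed

text \<open>Both traces are maxima over the same products of an entry of \<open>A\<close> and the
  transposed entry of \<open>B\<close>. It allows rotating factors of a product under the
  trace.\<close>

lemma mx_tr_mult_commute:
  fixes A B :: "real ^ 'n ^ 'n"
  shows "mx_tr (A \<otimes>\<^sub>m B) = mx_tr (B \<otimes>\<^sub>m A)"
proof -
  have "mx_tr (A \<otimes>\<^sub>m B) \<le> mx_tr (B \<otimes>\<^sub>m A)" for A B :: "real ^ 'n ^ 'n"
  proof -
    obtain i where i: "mx_tr (A \<otimes>\<^sub>m B) = (A \<otimes>\<^sub>m B) $ i $ i" by (rule mx_tr_attained)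
    obtain k where k: "(A \<otimes>\<^sub>m B) $ i $ i = A $ i $ k * B $ k $ i" by (rule mx_mult_attained)
    have "B $ k $ i * A $ i $ k \<le> (B \<otimes>\<^sub>m A) $ k $ k" by (rule mx_mult_ge)
    also have "\<dots> \<le> mx_tr (B \<otimes>\<^sub>m A)" by (rule mx_tr_ge)
    finally show ?thesis by (simp add: i k mult.commute)
  qed
  then show ?thesis by (simp add: antisym)
qed

lemma mx_power_add:
  assumes "nonneg_mat A"
  shows "mx_power A (p + q) = mx_power A p \<otimes>\<^sub>m mx_power A q"
  using assms by (induction p) (simp_all add: mx_mult_one_left mx_mult_assoc nonneg_mat_power)


section \<open>Walks and the Kleene star\<close>

text \<open>A list of vertices is read as a walk in the complete digraph with arc weights
  \<open>A\<close>. Lists with at most one vertex contain no arc and get the empty product.\<close>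

fun walk_weight :: "real ^ 'n ^ 'n \<Rightarrow> 'n list \<Rightarrow> real" where
  "walk_weight A (i # j # vs) = A $ i $ j * walk_weight A (j # vs)"
| "walk_weight A vs = 1"

text \<open>The walk is cut at \<open>v\<close>, which belongs to both parts, so that no arc is
  lost.\<close>

lemma walk_weight_append:
  "walk_weight A (us @ v # vs) = walk_weight A (us @ [v]) * walk_weight A (v # vs)"
  by (induction A us rule: walk_weight.induct) simp_all

lemma walk_weight_nonneg: "nonneg_mat A \<Longrightarrow> 0 \<le> walk_weight A vs"
  by (induction A vs rule: walk_weight.induct) (simp_all add: nonneg_mat_def)

lemma walk_weight_le_power:
  assumes "nonneg_mat A"
  shows "walk_weight A (v # vs) \<le> mx_power A (length vs) $ v $ last (v # vs)"
proof (induction vs arbitrary: v)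
  case Nil
  show ?case by (simp add: mat_def)
next
  case (Cons u vs)
  have "walk_weight A (v # u # vs) \<le> A $ v $ u * mx_power A (length vs) $ u $ last (u # vs)"
    using Cons assms by (simp add: mult_left_mono nonneg_mat_def)
  also have "\<dots> \<le> mx_power A (length (u # vs)) $ v $ last (v # u # vs)"
    by (simp add: mx_mult_ge)
  finally show ?case .
qed

text \<open>Each maximum in the iterated product is attained, which selects the next vertex. A
  nonzero entry is required since the off-diagonal zeros of the identity, the power 0, belong to no
  walk.\<close>

lemma power_eq_walk_weight:
  assumes "mx_power A p $ i $ j \<noteq> 0"
  shows "\<exists>vs. length vs = p \<and> last (i # vs) = j \<and> mx_power A p $ i $ j = walk_weight A (i # vs)"
  using assms
proof (induction p arbitrary: i)
  case 0
  then show ?case by (auto simp: mat_def split: if_splits)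
next
  case (Suc p)
  obtain k where k: "mx_power A (Suc p) $ i $ j = A $ i $ k * mx_power A p $ k $ j"
    using mx_mult_attained[of A "mx_power A p" i j] by auto
  with Suc.prems have "mx_power A p $ k $ j \<noteq> 0" by auto
  from Suc.IH[OF this] obtain vs where
    "length vs = p" "last (k # vs) = j" "mx_power A p $ k $ j = walk_weight A (k # vs)"
    by blast
  then show ?case using k by (intro exI[of _ "k # vs"]) simp
qed

lemma kleene_star_ge_power:
  fixes A :: "real ^ 'n ^ 'n"
  assumes "p < CARD('n)"
  shows "mx_power A p $ i $ j \<le> kleene_star A $ i $ j"
  unfolding kleene_star_def using assms by (intro mx_sum_ge) auto

lemma kleene_star_attained:
  fixes A :: "real ^ 'n ^ 'n"
  obtains p where "p < CARD('n)" "kleene_star A $ i $ j = mx_power A p $ i $ j"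
proof -
  obtain p where "p \<in> {0..CARD('n) - 1}" "kleene_star A $ i $ j = mx_power A p $ i $ j"
    unfolding kleene_star_def by (rule mx_sum_attained[of "{0..CARD('n) - 1}"]) auto
  moreover from this have "p < CARD('n)"
    using zero_less_card_finite[where 'a = 'n] unfolding atLeastAtMost_iff by linarith
  ultimately show ?thesis by (intro that[of p])
qed

lemma kleene_star_nonneg: "nonneg_mat A \<Longrightarrow> 0 \<le> kleene_star A $ i $ j"
  by (metis kleene_star_attained nonneg_mat_power nonneg_mat_def)

lemma kleene_star_diag_ge_1: "1 \<le> kleene_star A $ i $ i"
  using kleene_star_ge_power[of 0 A i i] by (simp add: mat_def)

text \<open>A walk with as many steps as there are vertices contains a cycle, and the condition on
  \<^const>\<open>mx_Tr\<close> allows cutting it out without decreasing the weight.\<close>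

lemma power_card_le_kleene_star:
  fixes A :: "real ^ 'n ^ 'n"
  assumes A: "nonneg_mat A" and Tr: "mx_Tr A \<le> 1"
  shows "mx_power A CARD('n) $ i $ j \<le> kleene_star A $ i $ j"
proof (cases "mx_power A CARD('n) $ i $ j = 0")
  case True
  then show ?thesis by (simp add: kleene_star_nonneg A)
next
  case False
  from power_eq_walk_weight[OF this] obtain vs where vs: "length vs = CARD('n)"
    "last (i # vs) = j" "mx_power A CARD('n) $ i $ j = walk_weight A (i # vs)" by blast
  \<comment> \<open>Pigeonhole: the walk lists one vertex more than there are.\<close>
  have "card (set (i # vs)) \<le> CARD('n)" by (rule card_mono) auto
  then have "\<not> distinct (i # vs)"
    using distinct_card[of "i # vs"] vs(1) by auto
  from not_distinct_decomp[OF this] obtain xs ys zs y where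
    dec: "i # vs = xs @ [y] @ ys @ [y] @ zs" by blast
  have len: "length xs + length ys + length zs + 2 = CARD('n) + 1"
    using arg_cong[OF dec, of length] vs(1) by simp
  \<comment> \<open>The segment between the two visits of \<open>y\<close> is cut out. If
    \<open>xs\<close> is empty, then \<open>y\<close> is \<open>i\<close>, so the shortened walk
    still starts at \<open>i\<close>.\<close>
  obtain ws where ws: "xs @ y # zs = i # ws"
    using dec by (cases xs) auto
  have len_ws: "length ws < CARD('n)"
    using arg_cong[OF ws, of length] len by simp
  have last_ws: "last (i # ws) = j"
    using vs(2) arg_cong[OF dec, of last] arg_cong[OF ws, of last] by simp
  have "walk_weight A (y # ys @ [y]) \<le> mx_power A (length ys + 1) $ y $ y"
    using walk_weight_le_power[OF A, of y "ys @ [y]"] by simp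
  \<comment> \<open>By \<open>len\<close> the cycle has at most as many steps as there are vertices,
    so its power is among those in \<open>mx_Tr\<close>.\<close>
  also have "\<dots> \<le> 1"
    using Tr len unfolding mx_Tr_le_iff by (auto simp del: mx_power.simps)
  finally have cycle: "walk_weight A (y # ys @ [y]) \<le> 1" .
  have "walk_weight A (i # vs) =
      walk_weight A (xs @ [y]) * (walk_weight A (y # ys @ [y]) * walk_weight A (y # zs))"
    using walk_weight_append[of A xs y "ys @ [y] @ zs"] walk_weight_append[of A "y # ys" y zs]
    by (simp add: dec)
  also have "\<dots> \<le> walk_weight A (xs @ [y]) * walk_weight A (y # zs)"
    using cycle by (intro mult_left_mono mult_left_le_one_le walk_weight_nonneg A)
  also have "\<dots> = walk_weight A (i # ws)"
    using walk_weight_append[of A xs y zs] ws by simp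
  also have "\<dots> \<le> mx_power A (length ws) $ i $ j"
    using walk_weight_le_power[OF A, of i ws] last_ws by simp
  also have "\<dots> \<le> kleene_star A $ i $ j"
    by (rule kleene_star_ge_power[OF len_ws])
  finally show ?thesis using vs by simp
qed

text \<open>Multiplication by \<open>A\<close> raises each power by one. Only the power
  \<open>CARD('n)\<close> then leaves the range of the star, and it was shown to be absorbed. Thus
  every column of the star satisfies the inequality \<open>A x \<le> x\<close>.\<close>

lemma mult_kleene_star_le:
  fixes A :: "real ^ 'n ^ 'n"
  assumes A: "nonneg_mat A" and Tr: "mx_Tr A \<le> 1"
  shows "A $ i $ k * kleene_star A $ k $ j \<le> kleene_star A $ i $ j"
proof -
  obtain p where p: "p < CARD('n)" "kleene_star A $ k $ j = mx_power A p $ k $ j"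
    by (rule kleene_star_attained)
  have "A $ i $ k * kleene_star A $ k $ j \<le> mx_power A (Suc p) $ i $ j"
    using p by (simp add: mx_mult_ge)
  also have "\<dots> \<le> kleene_star A $ i $ j"
  proof (cases "Suc p = CARD('n)")
    case True
    with power_card_le_kleene_star[OF A Tr, of i j] show ?thesis by simp
  next
    case False
    with p show ?thesis by (intro kleene_star_ge_power) auto
  qed
  finally show ?thesis .
qed


section \<open>Solutions of the inequality $Bx \le x$\<close>

text \<open>Has the form of the initial set of \<open>lex_state\<close>, so that all later sets can
  be described by changing the matrix only.\<close>

definition subeigenvectors :: "real ^ 'n ^ 'n \<Rightarrow> (real ^ 'n) set" where
  "subeigenvectors A = {x. nonneg_vec x \<and> regular_vec x \<and> A \<otimes>\<^sub>v x \<le> x}"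

lemma mem_subeigenvectors:
  "x \<in> subeigenvectors A \<longleftrightarrow> (\<forall>i. 0 < x $ i) \<and> (\<forall>i j. A $ i $ j * x $ j \<le> x $ i)"
  by (auto simp: subeigenvectors_def nonneg_vec_def regular_vec_def less_eq_vec_def
      mx_mult_vec_le_iff less_le)

text \<open>The inequality \<open>A x \<le> c x\<close> with the maxima on the left resolved into
  single products.\<close>

definition maps_below :: "real ^ 'n \<Rightarrow> real \<Rightarrow> real ^ 'n ^ 'n \<Rightarrow> bool" where
  "maps_below x c A \<longleftrightarrow> (\<forall>i j. A $ i $ j * x $ j \<le> c * x $ i)"

lemma maps_below_one: "(\<And>i. 0 < x $ i) \<Longrightarrow> maps_below x 1 (mat 1)"
  by (auto simp: maps_below_def mat_def less_imp_le)

text \<open>Monotonicity gives \<open>A B x \<le> d A x \<le> c d x\<close>.\<close>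

lemma maps_below_mult:
  assumes A: "nonneg_mat A" "maps_below x c A" and B: "maps_below x d B" "0 \<le> d"
  shows "maps_below x (c * d) (A \<otimes>\<^sub>m B)"
  unfolding maps_below_def
proof (intro allI)
  fix i j
  obtain k where k: "(A \<otimes>\<^sub>m B) $ i $ j = A $ i $ k * B $ k $ j"
    by (rule mx_mult_attained)
  have "A $ i $ k * (B $ k $ j * x $ j) \<le> A $ i $ k * (d * x $ k)"
    using A B by (intro mult_left_mono) (auto simp: maps_below_def nonneg_mat_def)
  also have "\<dots> = d * (A $ i $ k * x $ k)" by simp
  also have "\<dots> \<le> d * (c * x $ i)"
    using A B by (intro mult_left_mono) (auto simp: maps_below_def)
  finally show "(A \<otimes>\<^sub>m B) $ i $ j * x $ j \<le> c * d * x $ i"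
    by (simp add: k mult_ac)
qed

lemma maps_below_power:
  assumes "\<And>i. 0 < x $ i" "nonneg_mat A" "maps_below x 1 A"
  shows "maps_below x 1 (mx_power A p)"
proof (induction p)
  case (Suc p)
  then show ?case using maps_below_mult[of A x 1 1] assms by simp
qed (simp add: assms maps_below_one)

lemma subeigenvectors_maps_below:
  "x \<in> subeigenvectors A \<longleftrightarrow> (\<forall>i. 0 < x $ i) \<and> maps_below x 1 A"
  by (simp add: mem_subeigenvectors maps_below_def)

text \<open>Iterating \<open>A x \<le> x\<close> gives the same inequality for every power of
  \<open>A\<close>, and each entry of the star is an entry of some power.\<close>

lemma kleene_star_mult_le:
  assumes "nonneg_mat A" "x \<in> subeigenvectors A"
  shows "kleene_star A $ i $ j * x $ j \<le> x $ i"
proof -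
  obtain p where "kleene_star A $ i $ j = mx_power A p $ i $ j"
    by (rule kleene_star_attained)
  then show ?thesis
    using maps_below_power[of x A p] assms
    by (simp add: subeigenvectors_maps_below maps_below_def)
qed

text \<open>A single column of the star may contain zeros. The maximum of all columns is still a
  solution, and it is positive because the diagonal of the star is at least 1.\<close>

lemma subeigenvectors_nonempty:
  fixes A :: "real ^ 'n ^ 'n"
  assumes "nonneg_mat A" "mx_Tr A \<le> 1"
  shows "subeigenvectors A \<noteq> {}"
proof -
  define x :: "real ^ 'n" where "x = (\<chi> i. MAX j. kleene_star A $ i $ j)"
  have ge: "kleene_star A $ i $ j \<le> x $ i" for i j
    using le_MAX[of "\<lambda>j. kleene_star A $ i $ j"] by (simp add: x_def)
  have "A $ i $ j * x $ j \<le> x $ i" for i j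
  proof -
    obtain k where "x $ j = kleene_star A $ j $ k"
      using MAX_attained[of "\<lambda>k. kleene_star A $ j $ k"] by (auto simp: x_def)
    then show ?thesis
      using mult_kleene_star_le[OF assms, of i j k] ge[of i k] by simp
  qed
  moreover have "0 < x $ i" for i
    using ge[of i i] kleene_star_diag_ge_1[of A i] by simp
  ultimately have "x \<in> subeigenvectors A" by (simp add: mem_subeigenvectors)
  then show ?thesis by blast
qed

lemma kleene_star_mult_in_subeigenvectors:
  assumes A: "\<And>i j. 0 < A $ i $ j" and Tr: "mx_Tr A \<le> 1" and u: "nonneg_vec u" "u \<noteq> 0"
  shows "kleene_star A \<otimes>\<^sub>v u \<in> subeigenvectors A"
proof -
  have nn: "nonneg_mat A" using A by (simp add: nonneg_mat_def less_imp_le)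
  let ?x = "kleene_star A \<otimes>\<^sub>v u"
  have le: "A $ i $ j * ?x $ j \<le> ?x $ i" for i j
  proof -
    obtain k where k: "?x $ j = kleene_star A $ j $ k * u $ k" by (rule mx_mult_vec_attained)
    have "A $ i $ j * kleene_star A $ j $ k * u $ k \<le> kleene_star A $ i $ k * u $ k"
      using u by (intro mult_right_mono mult_kleene_star_le nn Tr) (simp add: nonneg_vec_def)
    also have "\<dots> \<le> ?x $ i" by (rule mx_mult_vec_ge)
    finally show ?thesis by (simp add: k mult.assoc)
  qed
  from u obtain j where j: "0 < u $ j"
    by (auto simp: vec_eq_iff nonneg_vec_def less_le)
  have "u $ j \<le> kleene_star A $ j $ j * u $ j"
    using j kleene_star_diag_ge_1[of A j] by simp
  also have "\<dots> \<le> ?x $ j" by (rule mx_mult_vec_ge)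
  finally have "0 < ?x $ j" using j by simp
  then have "0 < A $ i $ j * ?x $ j" for i using A by simp
  then have "0 < ?x $ i" for i using le[of i j] by (meson less_le_trans)
  with le show ?thesis by (simp add: mem_subeigenvectors)
qed

lemma subeigenvectors_eq_kleene_star:
  assumes A: "\<And>i j. 0 < A $ i $ j" and Tr: "mx_Tr A \<le> 1"
  shows "subeigenvectors A = {kleene_star A \<otimes>\<^sub>v u | u. nonneg_vec u \<and> u \<noteq> 0}" (is "_ = ?R")
proof (intro equalityI subsetI)
  fix x assume x: "x \<in> subeigenvectors A"
  have nn: "nonneg_mat A" using A by (simp add: nonneg_mat_def less_imp_le)
  have pos: "0 < x $ i" for i using x by (simp add: mem_subeigenvectors)
  \<comment> \<open>A solution is a fixed point of the star and so serves as its own parameter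
    \<open>u\<close>.\<close>
  have "kleene_star A \<otimes>\<^sub>v x = x"
  proof -
    have "x $ i \<le> (kleene_star A \<otimes>\<^sub>v x) $ i" for i
    proof -
      have "x $ i \<le> kleene_star A $ i $ i * x $ i"
        using pos kleene_star_diag_ge_1[of A i] by simp
      also have "\<dots> \<le> (kleene_star A \<otimes>\<^sub>v x) $ i" by (rule mx_mult_vec_ge)
      finally show ?thesis .
    qed
    moreover have "(kleene_star A \<otimes>\<^sub>v x) $ i \<le> x $ i" for i
      using kleene_star_mult_le[OF nn x] by (simp add: mx_mult_vec_le_iff)
    ultimately show ?thesis by (simp add: vec_eq_iff antisym)
  qed
  moreover have "nonneg_vec x" using pos by (simp add: nonneg_vec_def less_imp_le)
  moreover have "x \<noteq> 0" using pos by force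
  ultimately show "x \<in> ?R" by (intro CollectI exI[of _ x]) auto
next
  fix x assume "x \<in> ?R"
  then show "x \<in> subeigenvectors A"
    using kleene_star_mult_in_subeigenvectors[OF A Tr] by blast
qed


section \<open>The minimum of $x^- A x$ subject to $Bx \le x$\<close>

text \<open>For positive \<open>x\<close> the conjugate consists of true reciprocals, so the bound
  can be cleared of denominators row by row.\<close>

lemma objective_le_iff:
  assumes "\<And>i. 0 < x $ i"
  shows "objective A x \<le> c \<longleftrightarrow> maps_below x c A"
proof -
  have "objective A x \<le> c \<longleftrightarrow> (\<forall>i. (A \<otimes>\<^sub>v x) $ i \<le> c * x $ i)"
    using assms by (auto simp: objective_def mx_dot_def MAX_le_iff conjugate_def
        less_imp_neq[symmetric] field_simps)
  then show ?thesis by (simp add: mx_mult_vec_le_iff maps_below_def)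
qed

lemma mx_word_Nil: "mx_word A B [] = mat 1"
  by (simp add: mx_word_def)

lemma mx_word_Cons: "mx_word A B (i # ks) = (A \<otimes>\<^sub>m mx_power B i) \<otimes>\<^sub>m mx_word A B ks"
  by (simp add: mx_word_def)

lemma nonneg_mat_word: "nonneg_mat A \<Longrightarrow> nonneg_mat B \<Longrightarrow> nonneg_mat (mx_word A B ks)"
  by (induction ks)
    (simp_all add: mx_word_Nil mx_word_Cons nonneg_mat_one nonneg_mat_mult nonneg_mat_power)

text \<open>Trailing factors \<open>B\<close> are absorbed by the last exponent, which brings a
  rotated product back to the shape of a word.\<close>

lemma mx_word_snoc_mult_power:
  assumes "nonneg_mat A" "nonneg_mat B"
  shows "mx_word A B (ks @ [i]) \<otimes>\<^sub>m mx_power B j = mx_word A B (ks @ [i + j])"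
  using assms
  by (induction ks)
    (simp_all add: mx_word_Nil mx_word_Cons mx_mult_assoc mx_mult_one_right mx_power_add
      nonneg_mat_power nonneg_mat_mult nonneg_mat_word nonneg_mat_one)

text \<open>The two nested maxima range together over all nonempty words with at most
  \<open>CARD('n)\<close> factors \<open>A\<close> and \<open>B\<close> in total.\<close>

lemma theta_le_iff:
  fixes A B :: "real ^ 'n ^ 'n"
  shows "theta A B \<le> c \<longleftrightarrow>
    (\<forall>ks. ks \<noteq> [] \<and> length ks + sum_list ks \<le> CARD('n) \<longrightarrow>
      root (length ks) (mx_tr (mx_word A B ks)) \<le> c)"
proof -
  let ?S = "\<lambda>k. {ks :: nat list. length ks = k \<and> sum_list ks \<le> CARD('n) - k}"
  let ?f = "\<lambda>k ks. root k (mx_tr (mx_word A B ks))"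
  have fin: "finite (?S k)" for k
  proof (rule finite_subset)
    show "?S k \<subseteq> {ks. set ks \<subseteq> {..CARD('n)} \<and> length ks = k}"
      by (auto dest!: member_le_sum_list)
    show "finite {ks. set ks \<subseteq> {..CARD('n)} \<and> length ks = k}"
      by (rule finite_lists_length_eq) simp
  qed
  \<comment> \<open>The word with all exponents 0 is always admissible.\<close>
  have ne: "?S k \<noteq> {}" for k
    by (auto intro!: exI[of _ "replicate k 0"] simp: sum_list_replicate)
  have "theta A B \<le> c \<longleftrightarrow> (\<forall>k\<in>{1..CARD('n)}. (MAX ks\<in>?S k. ?f k ks) \<le> c)"
    unfolding theta_def by (subst Max_le_iff) auto
  also have "\<dots> \<longleftrightarrow> (\<forall>k\<in>{1..CARD('n)}. \<forall>ks\<in>?S k. ?f k ks \<le> c)"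
    using fin ne by (intro ball_cong refl, subst Max_le_iff) auto
  also have "\<dots> \<longleftrightarrow> (\<forall>ks. ks \<noteq> [] \<and> length ks + sum_list ks \<le> CARD('n) \<longrightarrow>
      root (length ks) (mx_tr (mx_word A B ks)) \<le> c)"
    by (auto simp: Suc_le_eq)
  finally show ?thesis .
qed

text \<open>With \<open>c\<close> the objective value, a word with \<open>k\<close> factors
  \<open>A\<close> maps \<open>x\<close> below \<open>c ^ k\<close> times \<open>x\<close>, as the
  factors \<open>B\<close> do not increase \<open>x\<close>. So its diagonal entries are at most
  \<open>c ^ k\<close>, and the root is at most \<open>c\<close>.\<close>

lemma theta_le_objective:
  fixes A B :: "real ^ 'n ^ 'n"
  assumes A: "nonneg_mat A" and B: "nonneg_mat B" and x: "x \<in> subeigenvectors B"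
  shows "theta A B \<le> objective A x"
proof -
  define c where "c = objective A x"
  have pos: "\<And>i. 0 < x $ i" and xB: "maps_below x 1 B"
    using x by (auto simp: subeigenvectors_maps_below)
  have xA: "maps_below x c A"
    using objective_le_iff[of x A c] pos c_def by simp
  have c: "0 \<le> c"
  proof -
    fix i
    have "0 \<le> A $ i $ i * x $ i" using A pos[of i] by (simp add: nonneg_mat_def)
    also have "\<dots> \<le> c * x $ i" using xA by (simp add: maps_below_def)
    finally show ?thesis using pos[of i] by (simp add: zero_le_mult_iff)
  qed
  have word: "maps_below x (c ^ length ks) (mx_word A B ks)" for ks
  proof (induction ks)
    case Nil
    then show ?case by (simp add: mx_word_Nil maps_below_one pos)
  next
    case (Cons k ks)
    have "maps_below x (c * 1) (A \<otimes>\<^sub>m mx_power B k)"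
      by (intro maps_below_mult A xA maps_below_power B xB pos) simp
    then show ?case
      using maps_below_mult[of "A \<otimes>\<^sub>m mx_power B k" x c "c ^ length ks"] Cons A B c
      by (simp add: mx_word_Cons nonneg_mat_mult nonneg_mat_power)
  qed
  have "root (length ks) (mx_tr (mx_word A B ks)) \<le> c" if "ks \<noteq> []" for ks
  proof -
    obtain i where i: "mx_tr (mx_word A B ks) = mx_word A B ks $ i $ i" by (rule mx_tr_attained)
    have "mx_word A B ks $ i $ i * x $ i \<le> c ^ length ks * x $ i"
      using word[of ks] by (simp add: maps_below_def)
    then have "mx_tr (mx_word A B ks) \<le> c ^ length ks" using pos[of i] i by simp
    then have "root (length ks) (mx_tr (mx_word A B ks)) \<le> root (length ks) (c ^ length ks)"
      using that by simp
    then show ?thesis using that c by (simp add: real_root_power_cancel)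
  qed
  then show ?thesis by (simp add: theta_le_iff c_def)
qed

lemma theta_ge:
  fixes A B :: "real ^ 'n ^ 'n"
  assumes "ks \<noteq> []" "length ks + sum_list ks \<le> CARD('n)"
  shows "root (length ks) (mx_tr (mx_word A B ks)) \<le> theta A B"
  using theta_le_iff[of A B "theta A B"] assms by blast

text \<open>The one-letter word with exponent 0 contributes the trace of \<open>A\<close>.
  Positivity makes \<open>inverse (theta A B)\<close> a genuine reciprocal.\<close>

lemma theta_pos:
  fixes A B :: "real ^ 'n ^ 'n"
  assumes "\<And>i j. 0 < A $ i $ j"
  shows "0 < theta A B"
proof -
  have A: "nonneg_mat A" using assms by (simp add: nonneg_mat_def less_imp_le)
  fix i
  have "0 < A $ i $ i" by (rule assms)
  also have "\<dots> \<le> mx_tr A" by (rule mx_tr_ge)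
  also have "\<dots> = root (length [0::nat]) (mx_tr (mx_word A B [0]))"
    by (simp add: mx_word_Cons mx_word_Nil mx_mult_one_right A)
  also have "\<dots> \<le> theta A B" by (rule theta_ge) (simp_all add: Suc_le_eq)
  finally show ?thesis .
qed

text \<open>Expanding a power of \<open>c A \<oplus> B\<close>, each entry is bounded by that of a single product of
  copies of \<open>A\<close> and \<open>B\<close>, in which \<open>k\<close> below is the number of leading factors \<open>B\<close>.\<close>

lemma power_le_word:
  fixes A B :: "real ^ 'n ^ 'n"
  assumes A: "nonneg_mat A" and B: "nonneg_mat B" and c: "0 \<le> c"
  shows "\<exists>k ks. k + length ks + sum_list ks = p \<and>
    mx_power (c *\<^sub>R A \<oplus>\<^sub>m B) p $ i $ j
      \<le> c ^ length ks * (mx_power B k \<otimes>\<^sub>m mx_word A B ks) $ i $ j"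
proof (induction p arbitrary: i)
  case 0
  have "(mat 1 \<otimes>\<^sub>m mat 1 :: real ^ 'n ^ 'n) = mat 1"
    by (simp add: mx_mult_one_left nonneg_mat_one)
  then show ?case by (intro exI[of _ 0] exI[of _ "[]"]) (simp add: mx_word_Nil)
next
  case (Suc p)
  let ?M = "c *\<^sub>R A \<oplus>\<^sub>m B"
  obtain l where l: "mx_power ?M (Suc p) $ i $ j = ?M $ i $ l * mx_power ?M p $ l $ j"
    using mx_mult_attained[of ?M "mx_power ?M p" i j] by auto
  obtain k ks where k: "k + length ks + sum_list ks = p" and
    le: "mx_power ?M p $ l $ j \<le> c ^ length ks * (mx_power B k \<otimes>\<^sub>m mx_word A B ks) $ l $ j"
    using Suc.IH by blast
  let ?W = "mx_power B k \<otimes>\<^sub>m mx_word A B ks"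
  have W: "nonneg_mat ?W" by (simp add: nonneg_mat_mult nonneg_mat_power nonneg_mat_word A B)
  have M: "?M $ i $ l = max (c * A $ i $ l) (B $ i $ l)" by (simp add: mx_add_def)
  have nnM: "0 \<le> ?M $ i $ l" using B by (simp add: M nonneg_mat_def le_max_iff_disj)
  have le': "mx_power ?M (Suc p) $ i $ j \<le> ?M $ i $ l * (c ^ length ks * ?W $ l $ j)"
    unfolding l by (rule mult_left_mono[OF le nnM])
  \<comment> \<open>The first factor is an entry of \<open>B\<close> or of \<open>c A\<close>. In
    the first case the leading block of factors \<open>B\<close> grows by one; in the second this
    block becomes the exponent of the new \<open>A\<close>, and the count of leading factors
    restarts at 0.\<close>
  show ?case
  proof (cases "?M $ i $ l = B $ i $ l")
    case True
    have "?M $ i $ l * (c ^ length ks * ?W $ l $ j) = c ^ length ks * (B $ i $ l * ?W $ l $ j)"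
      by (simp add: True)
    also have "\<dots> \<le> c ^ length ks * (B \<otimes>\<^sub>m ?W) $ i $ j"
      by (intro mult_left_mono mx_mult_ge) (simp add: c)
    also have "B \<otimes>\<^sub>m ?W = mx_power B (Suc k) \<otimes>\<^sub>m mx_word A B ks"
      by (simp add: mx_mult_assoc nonneg_mat_word A B)
    finally show ?thesis
      using le' k by (intro exI[of _ "Suc k"] exI[of _ ks]) simp
  next
    case False
    then have "?M $ i $ l = c * A $ i $ l" by (auto simp: M max_def split: if_splits)
    then have "?M $ i $ l * (c ^ length ks * ?W $ l $ j)
        = c ^ length (k # ks) * (A $ i $ l * ?W $ l $ j)" by simp
    also have "\<dots> \<le> c ^ length (k # ks) * (A \<otimes>\<^sub>m ?W) $ i $ j"
      by (intro mult_left_mono mx_mult_ge) (simp add: c)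
    also have "A \<otimes>\<^sub>m ?W = mx_power B 0 \<otimes>\<^sub>m mx_word A B (k # ks)"
      by (simp add: mx_word_Cons mx_mult_assoc mx_mult_one_left nonneg_mat_word nonneg_mat_mult
          nonneg_mat_power A B)
    finally show ?thesis
      using le' k by (intro exI[of _ 0] exI[of _ "k # ks"]) simp
  qed
qed

text \<open>On the diagonal, the leading factors \<open>B\<close> can be rotated to the end of the product.\<close>

lemma Tr_combined_le_1:
  fixes A B :: "real ^ 'n ^ 'n"
  assumes A: "\<And>i j. 0 < A $ i $ j" and B: "nonneg_mat B" and Tr: "mx_Tr B \<le> 1"
  shows "mx_Tr (inverse (theta A B) *\<^sub>R A \<oplus>\<^sub>m B) \<le> 1"
  unfolding mx_Tr_le_iff
proof (intro ballI allI)
  fix p i assume p: "p \<in> {1..CARD('n)}"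
  let ?t = "theta A B"
  have nnA: "nonneg_mat A" using A by (simp add: nonneg_mat_def less_imp_le)
  have t: "0 < ?t" by (rule theta_pos[OF A])
  obtain k ks where k: "k + length ks + sum_list ks = p" and
    le: "mx_power (inverse ?t *\<^sub>R A \<oplus>\<^sub>m B) p $ i $ i
      \<le> inverse ?t ^ length ks * (mx_power B k \<otimes>\<^sub>m mx_word A B ks) $ i $ i"
    using power_le_word[OF nnA B, of "inverse ?t" p i i] t by auto
  show "mx_power (inverse ?t *\<^sub>R A \<oplus>\<^sub>m B) p $ i $ i \<le> 1"
  \<comment> \<open>Without a factor \<open>A\<close> the product is a power of \<open>B\<close>,
    which is controlled by \<open>mx_Tr B\<close>.\<close>
  proof (cases ks rule: rev_cases)
    case Nil
    then have "k = p" using k by simp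
    moreover have "mx_power B p $ i $ i \<le> 1"
      using p Tr unfolding mx_Tr_le_iff by blast
    ultimately show ?thesis
      using le Nil by (simp add: mx_word_Nil mx_mult_one_right nonneg_mat_power B)
  next
    case (snoc ls l)
    let ?w = "ls @ [l + k]"
    have len: "length ?w = length ks" using snoc by simp
    have "(mx_power B k \<otimes>\<^sub>m mx_word A B ks) $ i $ i \<le> mx_tr (mx_power B k \<otimes>\<^sub>m mx_word A B ks)"
      by (rule mx_tr_ge)
    also have "\<dots> = mx_tr (mx_word A B ?w)"
      by (simp add: mx_tr_mult_commute[of "mx_power B k"] snoc mx_word_snoc_mult_power nnA B)
    also have "\<dots> \<le> ?t ^ length ks"
    proof -
      have tr: "0 \<le> mx_tr (mx_word A B ?w)"
        using mx_tr_ge[of "mx_word A B ?w" i] nonneg_mat_word[OF nnA B, of ?w]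
        by (meson nonneg_mat_def order_trans)
      \<comment> \<open>Rotation preserves the total number \<open>p\<close> of factors, so the word
        is admissible in \<open>theta\<close>.\<close>
      have "root (length ?w) (mx_tr (mx_word A B ?w)) \<le> ?t"
        using k p snoc by (intro theta_ge) auto
      then have "root (length ?w) (mx_tr (mx_word A B ?w)) ^ length ?w \<le> ?t ^ length ?w"
        using tr by (intro power_mono) simp_all
      moreover have "root (length ?w) (mx_tr (mx_word A B ?w)) ^ length ?w = mx_tr (mx_word A B ?w)"
        by (rule real_root_pow_pos2) (use tr in auto)
      ultimately show ?thesis unfolding len by simp
    qed
    finally have "inverse ?t ^ length ks * (mx_power B k \<otimes>\<^sub>m mx_word A B ks) $ i $ i
        \<le> inverse ?t ^ length ks * ?t ^ length ks"
      using t by (intro mult_left_mono) simp_all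
    also have "\<dots> = 1" using t by (simp add: power_inverse)
    finally show ?thesis using le by simp
  qed
qed

text \<open>Multiplication by a positive entry of \<open>x\<close> distributes over the maximum, so
  the inequality splits into \<open>A x \<le> t x\<close> and \<open>B x \<le> x\<close>.\<close>

lemma subeigenvectors_combined:
  fixes A B :: "real ^ 'n ^ 'n"
  assumes t: "0 < t"
  shows "subeigenvectors (inverse t *\<^sub>R A \<oplus>\<^sub>m B) = {x \<in> subeigenvectors B. objective A x \<le> t}"
proof -
  have "max (inverse t * a) b * z \<le> y \<longleftrightarrow> a * z \<le> t * y \<and> b * z \<le> y" if "0 < z" for a b y z
  proof -
    have "max (inverse t * a) b * z = max (inverse t * a * z) (b * z)"
      using that by (simp add: max_mult_distrib_right)
    then show ?thesis using t by (simp add: field_simps)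
  qed
  then have "(\<forall>i j. max (inverse t * A $ i $ j) (B $ i $ j) * x $ j \<le> x $ i) \<longleftrightarrow>
      (\<forall>i j. A $ i $ j * x $ j \<le> t * x $ i) \<and> (\<forall>i j. B $ i $ j * x $ j \<le> x $ i)"
    if "\<And>i. 0 < x $ i" for x :: "real ^ 'n"
    using that by blast
  then show ?thesis
    by (auto simp: mem_subeigenvectors mx_add_def objective_le_iff maps_below_def)
qed

lemma minimum_on_eqI:
  "x \<in> X \<Longrightarrow> f x = c \<Longrightarrow> (\<And>y. y \<in> X \<Longrightarrow> c \<le> f y) \<Longrightarrow> minimum_on f X = c"
  unfolding minimum_on_def by (rule Least_equality) auto

text \<open>The value \<open>theta A B\<close> is a lower bound, and the sublevel set at this value
  is the solution set of the combined matrix. That set is nonempty as \<open>mx_Tr\<close> of the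
  matrix is at most 1, so the bound is attained exactly there.\<close>

lemma objective_minimum:
  assumes A: "\<And>i j. 0 < A $ i $ j" and B: "nonneg_mat B" and Tr: "mx_Tr B \<le> 1"
  shows "minimum_on (objective A) (subeigenvectors B) = theta A B"
    and "{x. is_arg_min (objective A) (\<lambda>x. x \<in> subeigenvectors B) x} =
      subeigenvectors (inverse (theta A B) *\<^sub>R A \<oplus>\<^sub>m B)" (is "?L = ?R")
proof -
  have nnA: "nonneg_mat A" using A by (simp add: nonneg_mat_def less_imp_le)
  have R: "?R = {x \<in> subeigenvectors B. objective A x \<le> theta A B}"
    by (intro subeigenvectors_combined theta_pos A)
  have "nonneg_mat (inverse (theta A B) *\<^sub>R A \<oplus>\<^sub>m B)"
    using B by (simp add: nonneg_mat_def mx_add_def le_max_iff_disj)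
  then have "?R \<noteq> {}"
    by (intro subeigenvectors_nonempty Tr_combined_le_1 A B Tr)
  then obtain x where x: "x \<in> subeigenvectors B" "objective A x \<le> theta A B"
    unfolding R by blast
  have ge: "theta A B \<le> objective A y" if "y \<in> subeigenvectors B" for y
    by (rule theta_le_objective[OF nnA B that])
  show "minimum_on (objective A) (subeigenvectors B) = theta A B"
    using x ge by (intro minimum_on_eqI[of x]) (auto intro: antisym)
  show "?L = ?R"
    unfolding R is_arg_min_linorder using x ge by (auto intro: order_trans)
qed

text \<open>Both sides have the same upper bounds \<open>c\<close>. This reduces a step of the
  procedure to the minimization for a single matrix.\<close>

lemma objective_mx_sum:
  assumes L: "finite L" "L \<noteq> {}" and x: "\<And>i. 0 < x $ i"
  shows "(MAX l\<in>L. objective (C l) x) = objective (mx_sum L C) x"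
proof -
  have "(MAX l\<in>L. objective (C l) x) \<le> c \<longleftrightarrow> objective (mx_sum L C) x \<le> c" for c
  proof -
    have "(MAX l\<in>L. objective (C l) x) \<le> c \<longleftrightarrow> (\<forall>l\<in>L. maps_below x c (C l))"
      using L x by (subst Max_le_iff) (auto simp: objective_le_iff)
    also have "\<dots> \<longleftrightarrow> maps_below x c (mx_sum L C)"
    proof
      assume "\<forall>l\<in>L. maps_below x c (C l)"
      then show "maps_below x c (mx_sum L C)"
        unfolding maps_below_def using mx_sum_attained[OF L] by metis
    next
      assume *: "maps_below x c (mx_sum L C)"
      show "\<forall>l\<in>L. maps_below x c (C l)"
        unfolding maps_below_def
      proof (intro ballI allI)
        fix l i j assume "l \<in> L"
        then have "C l $ i $ j * x $ j \<le> mx_sum L C $ i $ j * x $ j"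
          using x L by (intro mult_right_mono mx_sum_ge) (auto intro: less_imp_le)
        also have "\<dots> \<le> c * x $ i" using * by (simp add: maps_below_def)
        finally show "C l $ i $ j * x $ j \<le> c * x $ i" .
      qed
    qed
    also have "\<dots> \<longleftrightarrow> objective (mx_sum L C) x \<le> c"
      using x by (simp add: objective_le_iff)
    finally show ?thesis .
  qed
  then show ?thesis by (meson antisym order_refl)
qed


section \<open>The lexicographic procedure\<close>

text \<open>Invariant of both recursions run in parallel. By \<open>objective_minimum\<close> the
  minima compared in \<open>lex_state\<close> are the values of \<open>theta\<close> compared in
  \<open>bound_state\<close>, so the index sets agree. The last two clauses ensure that for
  \<open>1 \<le> m\<close> the first step is really taken and makes the matrix positive.\<close>

lemma lex_state_eq_bound_state:
  assumes C: "\<And>l i j. l \<in> {1..m} \<Longrightarrow> 0 < C l $ i $ j"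
    and B: "nonneg_mat B" "mx_Tr B \<le> 1"
  shows "\<exists>B' I. bound_state C m B s = (B', I) \<and> lex_state C m B s = (subeigenvectors B', I) \<and>
    I \<subseteq> {1..m} \<and> nonneg_mat B' \<and> mx_Tr B' \<le> 1 \<and>
    (0 < s \<and> 1 \<le> m \<longrightarrow> (\<forall>i j. 0 < B' $ i $ j)) \<and> (s = 0 \<longrightarrow> I = {1..m})"
proof (induction s)
  case 0
  show ?case using B by (auto simp: subeigenvectors_def)
next
  case (Suc s)
  then obtain B' I where bs: "bound_state C m B s = (B', I)"
    and ls: "lex_state C m B s = (subeigenvectors B', I)"
    and I: "I \<subseteq> {1..m}" and B': "nonneg_mat B'" "mx_Tr B' \<le> 1"
    and pos: "0 < s \<and> 1 \<le> m \<longrightarrow> (\<forall>i j. 0 < B' $ i $ j)" and I0: "s = 0 \<longrightarrow> I = {1..m}"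
    by blast
  show ?case
  proof (cases "I = {}")
    case True
    \<comment> \<open>The state repeats. For \<open>s = 0\<close> an empty index set means
      \<open>m = 0\<close>, and the positivity clause is vacuous.\<close>
    then show ?thesis using bs ls B' pos I0 by (cases "s = 0") auto
  next
    case False
    have fin: "finite I" using I finite_subset by blast
    define A where "A = mx_sum I C"
    define B'' where "B'' = inverse (theta A B') *\<^sub>R A \<oplus>\<^sub>m B'"
    define f where "f = (\<lambda>x. MAX l\<in>I. objective (C l) x)"
    have A: "0 < A $ i $ j" for i j
      unfolding A_def using mx_sum_attained[OF fin False, of C i j] C I by (metis subsetD)
    have t: "0 < theta A B'" by (rule theta_pos[OF A])
    have B''pos: "0 < B'' $ i $ j" for i j
      using A[of i j] t by (simp add: B''_def mx_add_def less_max_iff_disj)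
    then have B''nn: "nonneg_mat B''" by (simp add: nonneg_mat_def less_imp_le)
    have B''Tr: "mx_Tr B'' \<le> 1" unfolding B''_def by (rule Tr_combined_le_1[OF A B'])
    have f: "f x = objective A x" if "x \<in> subeigenvectors B'" for x
      using that unfolding f_def A_def
      by (intro objective_mx_sum fin False) (simp add: mem_subeigenvectors)
    have "{x. is_arg_min f (\<lambda>x. x \<in> subeigenvectors B') x} =
        {x. is_arg_min (objective A) (\<lambda>x. x \<in> subeigenvectors B') x}"
      using f by (auto simp: is_arg_min_def)
    then have argmin: "{x. is_arg_min f (\<lambda>x. x \<in> subeigenvectors B') x} = subeigenvectors B''"
      using objective_minimum(2)[OF A B'] by (simp add: B''_def)
    \<comment> \<open>\<open>minimum_on\<close> depends on the function only through its image of
      the set.\<close>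
    have "f ` subeigenvectors B' = objective A ` subeigenvectors B'"
      using f by (intro image_cong) auto
    then have min: "minimum_on f (subeigenvectors B') = theta A B'"
      using objective_minimum(1)[OF A B'] by (simp add: minimum_on_def)
    have minl: "minimum_on (objective (C l)) (subeigenvectors B'') = theta (C l) B''"
      if "l \<in> I" for l
      using objective_minimum(1)[of "C l" B'', OF _ B''nn B''Tr] C that I by blast
    let ?I = "{l \<in> I. theta (C l) B'' < theta A B'}"
    have "bound_state C m B (Suc s) = (B'', ?I)"
      using False by (simp add: bs Let_def A_def B''_def)
    moreover have "lex_state C m B (Suc s) = (subeigenvectors B'', ?I)"
      using False argmin min minl by (simp add: ls Let_def f_def[symmetric] cong: conj_cong)
    ultimately show ?thesis using I B''nn B''Tr B''pos by auto
  qed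
qed


section \<open>Best and worst differentiating solutions\<close>

lemma one_mx_dot: "1 \<odot> x = mx_norm x"
  by (simp add: mx_dot_def mx_norm_def)

lemma mx_dot_one: "x \<odot> 1 = mx_norm x"
  by (simp add: mx_dot_def mx_norm_def)

lemma mx_norm_ge: "x $ i \<le> mx_norm x"
  using le_MAX[of "\<lambda>i. x $ i"] by (simp add: mx_norm_def)

lemma mx_norm_le_iff: "mx_norm x \<le> c \<longleftrightarrow> (\<forall>i. x $ i \<le> c)"
  by (simp add: mx_norm_def MAX_le_iff)

lemma mx_norm_attained: obtains i where "mx_norm x = x $ i"
  using MAX_attained[of "\<lambda>i. x $ i"] by (auto simp: mx_norm_def)

lemma mx_norm_pos: "(\<And>i. 0 < x $ i) \<Longrightarrow> 0 < mx_norm x"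
  by (metis mx_norm_attained)

lemma mx_norm_scaleR:
  assumes "0 < c"
  shows "mx_norm (c *\<^sub>R x) = c * mx_norm x"
proof -
  have "mx_norm (c *\<^sub>R x) \<le> d \<longleftrightarrow> c * mx_norm x \<le> d" for d
    using assms mx_norm_le_iff[of x "d / c"]
    by (simp add: mx_norm_le_iff[of "c *\<^sub>R x"] field_simps)
  then show ?thesis by (meson antisym order_refl)
qed

lemma conjugate_scaleR: "conjugate (c *\<^sub>R x) = inverse c *\<^sub>R conjugate x"
  by (auto simp: conjugate_def vec_eq_iff)

lemma mx_norm_conjugate_antimono:
  assumes "\<And>i. 0 < x $ i" "x \<le> y"
  shows "mx_norm (conjugate y) \<le> mx_norm (conjugate x)"
  unfolding mx_norm_le_iff
proof
  fix i
  have "0 < x $ i" "x $ i \<le> y $ i" using assms by (auto simp: less_eq_vec_def)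
  then have "conjugate y $ i \<le> conjugate x $ i"
    by (simp add: conjugate_def le_imp_inverse_le)
  also have "\<dots> \<le> mx_norm (conjugate x)" by (rule mx_norm_ge)
  finally show "conjugate y $ i \<le> mx_norm (conjugate x)" .
qed

lemma subeigenvectors_scaleR:
  assumes "0 < c" "x \<in> subeigenvectors A"
  shows "c *\<^sub>R x \<in> subeigenvectors A"
  using assms by (simp add: mem_subeigenvectors mult.left_commute)

text \<open>Since \<open>f\<close> is antitone and every member of \<open>N\<close> lies above some
  \<open>h k\<close>, the maximum of \<open>f\<close> over \<open>N\<close> is attained in the
  finite family \<open>h\<close>, and every maximizer lies above a maximizing
  \<open>h k\<close>.\<close>

lemma minimal_given_by_arg_max:
  fixes N :: "(real ^ 'n) set" and f :: "real ^ 'n \<Rightarrow> real"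
    and h :: "'k :: finite \<Rightarrow> real ^ 'n"
  assumes h: "\<And>k. h k \<in> N" and below: "\<And>y. y \<in> N \<Longrightarrow> \<exists>k. h k \<le> y"
    and anti: "\<And>x y. x \<in> N \<Longrightarrow> x \<le> y \<Longrightarrow> f y \<le> f x"
  shows "minimal_given_by {x. is_arg_max f (\<lambda>x. x \<in> N) x}
    {h k | k. is_arg_max (\<lambda>k. f (h k)) (\<lambda>k. True) k}"
    (is "minimal_given_by ?D ?S")
proof -
  have D: "x \<in> ?D \<longleftrightarrow> x \<in> N \<and> (\<forall>y\<in>N. f y \<le> f x)" for x
    by (auto simp: is_arg_max_linorder)
  have S: "?S = h ` {k. \<forall>l. f (h l) \<le> f (h k)}"
    by (auto simp: is_arg_max_linorder)
  have finS: "finite ?S" unfolding S by simp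
  have SD: "?S \<subseteq> ?D"
  proof
    fix x assume "x \<in> ?S"
    then obtain k where k: "x = h k" "\<And>l. f (h l) \<le> f (h k)" unfolding S by auto
    have "f y \<le> f x" if y: "y \<in> N" for y
    proof -
      obtain l where "h l \<le> y" using below[OF y] by blast
      then have "f y \<le> f (h l)" using anti h by blast
      then show ?thesis using k(2)[of l] k(1) by simp
    qed
    then show "x \<in> ?D" using D k h by simp
  qed
  have DS: "\<exists>y\<in>?S. y \<le> x" if x: "x \<in> ?D" for x
  proof -
    obtain k where k: "h k \<le> x" using below x D by blast
    have "f (h l) \<le> f (h k)" for l
      using x anti[OF h k] h[of l] unfolding D by (meson order_trans)
    then have "h k \<in> ?S" unfolding S by blast
    then show ?thesis using k by blast
  qed
  have least: "minimal_elements ?D = {y}" if y: "y \<in> ?S" "\<forall>z\<in>?S. y \<le> z" for y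
  proof -
    have "y \<in> ?D" using SD y(1) by (rule subsetD)
    moreover have "y \<le> x" if "x \<in> ?D" for x
      using DS[OF that] y(2) by (meson order_trans)
    ultimately show ?thesis unfolding minimal_elements_def by (auto intro: antisym)
  qed
  \<comment> \<open>Contrapositive of the last condition in \<open>minimal_given_by\<close>.\<close>
  have "\<exists>y\<in>?S. \<forall>z\<in>?S. y \<le> z" if ex1: "\<exists>!x. x \<in> minimal_elements ?D"
  proof -
    obtain x where x: "x \<in> minimal_elements ?D"
      and uniq: "\<And>y. y \<in> minimal_elements ?D \<Longrightarrow> y = x"
      using ex1 by blast
    have xD: "x \<in> ?D" and xmin: "\<And>y. y \<in> ?D \<Longrightarrow> y \<le> x \<Longrightarrow> y = x"
      using x unfolding minimal_elements_def by blast+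
    obtain y where y: "y \<in> ?S" "y \<le> x" using DS[OF xD] by blast
    have "y = x" using xmin[OF subsetD[OF SD y(1)] y(2)] .
    then have xS: "x \<in> ?S" using y(1) by simp
    have "x \<le> z" if z: "z \<in> ?S" for z
    proof -
      \<comment> \<open>By finiteness \<open>z\<close> lies above a minimal element \<open>m\<close>
        of \<open>?S\<close>. It is minimal in \<open>?D\<close> too, because every member of
        \<open>?D\<close> lies above one of \<open>?S\<close>; uniqueness then identifies it with
        \<open>x\<close>.\<close>
      obtain m where m: "m \<in> ?S" "m \<le> z" and min: "\<And>b. b \<in> ?S \<Longrightarrow> b \<le> m \<Longrightarrow> m = b"
        using finite_has_minimal2[OF finS z] by blast
      have "w = m" if w: "w \<in> ?D" "w \<le> m" for w
      proof -
        obtain v where v: "v \<in> ?S" "v \<le> w" using DS[OF w(1)] by blast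
        then have "m = v" using min w(2) by (meson order_trans)
        then show ?thesis using v w by (simp add: antisym)
      qed
      then have "m \<in> minimal_elements ?D"
        using subsetD[OF SD m(1)] unfolding minimal_elements_def by blast
      then show ?thesis using uniq m(2) by blast
    qed
    then show ?thesis using xS by blast
  qed
  then show ?thesis
    unfolding minimal_given_by_def using finS SD DS least by blast
qed

lemma column_kleene_star_in_subeigenvectors:
  assumes A: "\<And>i j. 0 < A $ i $ j" and Tr: "mx_Tr A \<le> 1"
  shows "column j (kleene_star A) \<in> subeigenvectors A"
proof -
  have nn: "nonneg_mat A" using A by (simp add: nonneg_mat_def less_imp_le)
  note le = mult_kleene_star_le[OF nn Tr]
  have "0 < kleene_star A $ i $ j" for i
  proof -
    have "0 < A $ i $ j * kleene_star A $ j $ j"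
      using A kleene_star_diag_ge_1[of A j] by (intro mult_pos_pos) auto
    also have "\<dots> \<le> kleene_star A $ i $ j" by (rule le)
    finally show ?thesis .
  qed
  then show ?thesis using le by (simp add: mem_subeigenvectors column_def)
qed

lemma minimal_best_differentiating:
  assumes A: "\<And>i j. 0 < A $ i $ j" and Tr: "mx_Tr A \<le> 1" and G: "G = kleene_star A"
  shows "minimal_given_by (best_differentiating (subeigenvectors A))
    {inverse (mx_norm (column k G)) *\<^sub>R column k G | k.
      is_arg_max (\<lambda>j. mx_norm (column j G) * mx_norm (conjugate (column j G))) (\<lambda>j. True) k}"
proof -
  have nn: "nonneg_mat A" using A by (simp add: nonneg_mat_def less_imp_le)
  define N where "N = {x \<in> subeigenvectors A. mx_norm x = 1}"
  define h where "h k = inverse (mx_norm (column k G)) *\<^sub>R column k G" for k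
  have col: "column k G \<in> subeigenvectors A" for k
    unfolding G by (rule column_kleene_star_in_subeigenvectors[OF A Tr])
  then have norm_col: "0 < mx_norm (column k G)" for k
    by (intro mx_norm_pos) (simp add: mem_subeigenvectors)
  \<comment> \<open>Normalizing a column multiplies its conjugate by the norm, which produces the
    product of norms to be maximized.\<close>
  have f: "mx_norm (conjugate (h k)) = mx_norm (column k G) * mx_norm (conjugate (column k G))" for k
    using norm_col[of k] by (simp add: h_def conjugate_scaleR mx_norm_scaleR)
  have hN: "h k \<in> N" for k
    using norm_col[of k] col[of k]
    by (simp add: h_def N_def subeigenvectors_scaleR mx_norm_scaleR)
  have below: "\<exists>k. h k \<le> y" if y: "y \<in> N" for y
  proof -
    obtain k where k: "mx_norm y = y $ k" by (rule mx_norm_attained)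
    have yk: "y $ k = 1" and yX: "y \<in> subeigenvectors A" using y k by (auto simp: N_def)
    have le: "column k G \<le> y"
      using kleene_star_mult_le[OF nn yX, of _ k] by (simp add: yk G column_def less_eq_vec_def)
    \<comment> \<open>Since the norm is at least 1, normalization can only shrink the
      column.\<close>
    have "1 \<le> mx_norm (column k G)"
      using kleene_star_diag_ge_1[of A k] mx_norm_ge[of "column k G" k] by (simp add: G column_def)
    then have "h k \<le> column k G"
      using col[of k]
      by (simp add: h_def less_eq_vec_def mem_subeigenvectors mult_left_le_one_le less_imp_le
          inverse_le_1_iff)
    with le show ?thesis by (meson order_trans)
  qed
  have "minimal_given_by {x. is_arg_max (\<lambda>x. mx_norm (conjugate x)) (\<lambda>x. x \<in> N) x}
    {h k | k. is_arg_max (\<lambda>k. mx_norm (conjugate (h k))) (\<lambda>k. True) k}"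
    by (rule minimal_given_by_arg_max[OF hN below mx_norm_conjugate_antimono])
      (auto simp: N_def mem_subeigenvectors)
  then show ?thesis
    by (simp add: best_differentiating_def one_mx_dot mx_dot_one f) (simp add: N_def h_def)
qed

text \<open>The candidate dominates every normalized solution, and the objective decreases in
  \<open>x\<close>. Its norm is 1 because the column of least norm attains its maximum in a row \<open>k\<close> whose
  own column has norm at most 1.\<close>

lemma maximal_worst_differentiating:
  assumes A: "\<And>i j. 0 < A $ i $ j" and Tr: "mx_Tr A \<le> 1" and G: "G = kleene_star A"
  shows "maximal_given_by (worst_differentiating (subeigenvectors A)) (conjugate (1 \<^sub>v\<otimes> G))"
proof -
  have nn: "nonneg_mat A" using A by (simp add: nonneg_mat_def less_imp_le)
  let ?x = "conjugate (1 \<^sub>v\<otimes> G)"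
  let ?g = "\<lambda>j. mx_norm (column j G)"
  have col: "column j G \<in> subeigenvectors A" for j
    unfolding G by (rule column_kleene_star_in_subeigenvectors[OF A Tr])
  have g_ge: "G $ i $ j \<le> ?g j" for i j
    using mx_norm_ge[of "column j G" i] by (simp add: column_def)
  have g_att: "\<exists>k. ?g j = G $ k $ j" for j
    using mx_norm_attained[of "column j G"] by (auto simp: column_def)
  have g_pos: "0 < ?g j" for j
    using col[of j] by (intro mx_norm_pos) (simp add: mem_subeigenvectors)
  have g_ge_1: "1 \<le> ?g j" for j
    using g_ge[of j j] kleene_star_diag_ge_1[of A j] by (simp add: G)
  \<comment> \<open>The entries of the row vector \<open>1 \<^sub>v\<otimes> G\<close> are the
    column norms of \<open>G\<close>.\<close>
  have x: "?x $ j = inverse (?g j)" for j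
    using g_pos[of j] by (simp add: conjugate_def vec_mx_mult_def mx_norm_def column_def)
  have GG: "G $ i $ k * G $ k $ j \<le> G $ i $ j" for i j k
    using kleene_star_mult_le[OF nn col, of i k j] by (simp add: G column_def)
  \<comment> \<open>With \<open>k\<close> the row where column \<open>i\<close> attains its norm,
    the left side is \<open>G $ k $ i * G $ i $ j\<close>, at most \<open>G $ k $ j\<close>.\<close>
  have g_mult: "?g i * G $ i $ j \<le> ?g j" for i j
    using g_att[of i] GG g_ge by (metis order_trans)
  have xX: "?x \<in> subeigenvectors A"
    unfolding mem_subeigenvectors
  proof (intro conjI allI)
    show "0 < ?x $ i" for i using g_pos by (simp add: x)
    fix i j
    \<comment> \<open>The star dominates \<open>A\<close>, so \<open>g_mult\<close> carries over
      from entries of \<open>G\<close> to entries of \<open>A\<close>.\<close>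
    have "A $ i $ j * 1 \<le> A $ i $ j * G $ j $ j"
      using A[of i j] kleene_star_diag_ge_1[of A j] by (intro mult_left_mono) (auto simp: G)
    also have "\<dots> \<le> G $ i $ j" unfolding G by (rule mult_kleene_star_le[OF nn Tr])
    finally have "?g i * A $ i $ j \<le> ?g i * G $ i $ j"
      using g_pos[of i] by simp
    also note g_mult[of i j]
    finally have "A $ i $ j / ?g j \<le> 1 / ?g i"
      using g_pos[of i] g_pos[of j] by (simp add: divide_le_eq le_divide_eq mult.commute)
    then show "A $ i $ j * ?x $ j \<le> ?x $ i"
      by (simp add: x divide_inverse)
  qed
  have x_norm: "mx_norm ?x = 1"
  proof (rule antisym)
    show "mx_norm ?x \<le> 1"
      using g_ge_1 by (simp add: mx_norm_le_iff x inverse_le_1_iff)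
    have "Min (range ?g) \<in> range ?g" by (rule Min_in) auto
    then obtain j where "Min (range ?g) = ?g j" by (rule rangeE)
    then have j: "?g j \<le> ?g i" for i
      using Min_le[of "range ?g" "?g i"] by simp
    obtain k where k: "?g j = G $ k $ j" using g_att by blast
    have "?g k * ?g j \<le> ?g j" using g_mult[of k j] k by simp
    then have "?g k \<le> 1" using g_pos[of j] by simp
    then have "1 \<le> ?x $ k" using g_pos[of k] by (simp add: x one_le_inverse)
    then show "1 \<le> mx_norm ?x" using mx_norm_ge[of ?x k] by simp
  qed
  have upper: "y \<le> ?x" if y: "y \<in> subeigenvectors A" "mx_norm y = 1" for y
    unfolding less_eq_vec_def
  proof
    fix j
    obtain k where "?g j = G $ k $ j" using g_att by blast
    then have "?g j * y $ j \<le> y $ k"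
      using kleene_star_mult_le[OF nn y(1), of k j] by (simp add: G)
    also have "\<dots> \<le> 1" using mx_norm_ge[of y k] y(2) by simp
    finally have "y $ j \<le> 1 / ?g j"
      using g_pos[of j] by (simp add: le_divide_eq mult.commute)
    then show "y $ j \<le> ?x $ j" by (simp add: x divide_inverse)
  qed
  have min: "mx_norm (conjugate ?x) \<le> mx_norm (conjugate y)"
    if y: "y \<in> subeigenvectors A" "mx_norm y = 1" for y
    by (rule mx_norm_conjugate_antimono[OF _ upper[OF y]]) (use y in \<open>simp add: mem_subeigenvectors\<close>)
  show ?thesis
    unfolding maximal_given_by_def worst_differentiating_def is_arg_min_linorder
      one_mx_dot mx_dot_one
    using xX x_norm min upper by blast
qed

theorem theorem11:
  fixes C :: "nat \<Rightarrow> real ^ 'n ^ 'n" and B G :: "real ^ 'n ^ 'n" and m :: nat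
    and X :: "(real ^ 'n) set"
  assumes "m \<ge> 1"
    and "\<forall>l\<in>{1..m}. nonneg_mat (C l) \<and> pairwise_comparison (C l) \<and> mx_spectral_radius (C l) \<noteq> 0"
    and "nonneg_mat B" and "mx_Tr B \<le> 1"
    and "G = kleene_star (fst (bound_state C m B m))"
    and "X = lex_max_solutions C m B"
  shows "X = {G \<otimes>\<^sub>v u | u. nonneg_vec u \<and> u \<noteq> 0}
    \<and> minimal_given_by (best_differentiating X)
        {inverse (mx_norm (column k G)) *\<^sub>R column k G | k.
           is_arg_max (\<lambda>j. mx_norm (column j G) * mx_norm (conjugate (column j G))) (\<lambda>j. True) k}
    \<and> maximal_given_by (worst_differentiating X) (conjugate (1 \<^sub>v\<otimes> G))"
proof -
  define B' where "B' = fst (bound_state C m B m)"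
  have C: "0 < C l $ i $ j" if "l \<in> {1..m}" for l i j
    using assms(2) that unfolding pairwise_comparison_def by blast
  obtain B'' I where "bound_state C m B m = (B'', I)" "lex_state C m B m = (subeigenvectors B'', I)"
    "mx_Tr B'' \<le> 1" "0 < m \<and> 1 \<le> m \<longrightarrow> (\<forall>i j. 0 < B'' $ i $ j)"
    using lex_state_eq_bound_state[of m C B m, OF C assms(3,4)] by blast
  \<comment> \<open>The hypothesis \<open>m \<ge> 1\<close> enters here: it makes the final matrix
    positive, as the results on its star require.\<close>
  then have X: "X = subeigenvectors B'" and pos: "\<And>i j. 0 < B' $ i $ j" and Tr: "mx_Tr B' \<le> 1"
    using assms(1) by (simp_all add: assms(6) lex_max_solutions_def B'_def)
  have G: "G = kleene_star B'" by (simp add: assms(5) B'_def)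
  show ?thesis
    unfolding X
    by (intro conjI subeigenvectors_eq_kleene_star[OF pos Tr, folded G]
        minimal_best_differentiating[OF pos Tr G] maximal_worst_differentiating[OF pos Tr G])
qed

end
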